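(* Let $t$ be a positive odd integer. For any bar-partition $\lambda$, with $t$-bar core $\lambda_{(\overline t)}$ and associated $t$-bar cocore partition $\lambda^{[\overline t]}$, we have $$\ell(\lambda)-\ell(\lambda_{(\overline t)})-\ell(\lambda^{[\overline t]})\equiv 0\mod 2.$$
   Context: A bar-partition is a partition with pairwise distinct parts (the empty partition is allowed); $\ell(\lambda)$ is the number of parts of $\lambda$. **$t$-bar Littlewood decomposition ($t$ odd positive).** Let $\lambda$ be a bar-partition, $\mathbb N=\{0,1,2,\dots\}$. For $0\le r\le t-1$ let $X_r=\{x\in\mathbb N : tx+r \text{ is a part of }\lambda\}$. For $1\le r\le (t-1)/2$ put $M_r=X_r\cup\{-1-x : x\in\mathbb N,\ x\notin X_{t-r}\}\subset\mathbb Z$ (the black beads of the $r$-th runner of the twisted $t$-bar-abacus, the fence being between $-1$ and $0$), and $c_r=|X_r|-|X_{t-r}|$. The $t$-bar quotient is $\lambda^{(\overline t)}=(\lambda^0,\lambda^1,\dots,\lambda^{(t-1)/2})$, where $\lambda^0$ is the bar-partition whose set of parts is $X_0$, and, for $r\ge1$, $\lambda^r$ is the partition whose Frobenius symbol has set of arms $\{x\ge 0: x\in M_r-c_r\}$ and set of legs $\{x\ge 0: -1-x\notin M_r-c_r\}$ (with $M_r-c_r=\{m-c_r:m\in M_r\}$; these two sets have the same cardinality). The $t$-bar core $\lambda_{(\overline t)}$ is the bar-partition whose parts are, for each $1\le r\le (t-1)/2$: $r,r+t,\dots,r+(c_r-1)t$ if $c_r>0$; $(t-r),(t-r)+t,\dots,(t-r)+(|c_r|-1)t$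 if $c_r<0$; nothing if $c_r=0$. A bar-partition is uniquely determined by its $t$-bar core and its $t$-bar quotient, and all pairs occur. The $t$-bar cocore partition $\lambda^{[\overline t]}$ associated with $\lambda$ is the bar-partition with empty $t$-bar core and the same $t$-bar quotient as $\lambda$. *)

theory Defs
  imports "HOL-Number_Theory.Cong"
begin

text \<open>Partitions are weakly decreasing lists of positive parts, so the number of parts is
  \<^const>\<open>length\<close>.\<close>

definition partition :: "nat list \<Rightarrow> bool" where
  "partition p \<longleftrightarrow> sorted_wrt (\<ge>) p \<and> 0 \<notin> set p"

definition bar_partition :: "nat list \<Rightarrow> bool" where
  "bar_partition p \<longleftrightarrow> partition p \<and> distinct p"

text \<open>Meant for finite sets of positive numbers only.\<close>

definition bar_partition_of_set :: "nat set \<Rightarrow> nat list" where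
  "bar_partition_of_set S = rev (sorted_list_of_set S)"

definition conjugate_part :: "nat list \<Rightarrow> nat \<Rightarrow> nat" where
  "conjugate_part p j = card {i. i < length p \<and> j < p ! i}"

text \<open>Rows and columns are numbered from 0, so the diagonal cell \<open>(i, i)\<close> belongs to the Young
  diagram iff \<open>i < p ! i\<close>; it has arm length \<open>p ! i - i - 1\<close>, and dually for the leg length.\<close>

definition frobenius_arms :: "nat list \<Rightarrow> nat set" where
  "frobenius_arms p = {p ! i - Suc i | i. i < length p \<and> i < p ! i}"

definition frobenius_legs :: "nat list \<Rightarrow> nat set" where
  "frobenius_legs p = {conjugate_part p i - Suc i | i. i < length p \<and> i < p ! i}"

definition partition_of_frobenius :: "nat set \<Rightarrow> nat set \<Rightarrow> nat list" where
  "partition_of_frobenius A L =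
     (THE p. partition p \<and> frobenius_arms p = A \<and> frobenius_legs p = L)"

definition runner_parts :: "nat \<Rightarrow> nat list \<Rightarrow> nat \<Rightarrow> nat set" where
  "runner_parts t p r = {x. t * x + r \<in> set p}"

text \<open>Black beads of the \<open>r\<close>-th runner of the twisted \<open>t\<close>-bar-abacus, for
  \<open>1 \<le> r \<le> (t - 1) div 2\<close>; the fence is between \<open>-1\<close> and \<open>0\<close>.\<close>

definition beads :: "nat \<Rightarrow> nat list \<Rightarrow> nat \<Rightarrow> int set" where
  "beads t p r = int ` runner_parts t p r \<union> {- 1 - int x | x. x \<notin> runner_parts t p (t - r)}"

definition charge :: "nat \<Rightarrow> nat list \<Rightarrow> nat \<Rightarrow> int" where
  "charge t p r = int (card (runner_parts t p r)) - int (card (runner_parts t p (t - r)))"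

definition shifted_beads :: "nat \<Rightarrow> nat list \<Rightarrow> nat \<Rightarrow> int set" where
  "shifted_beads t p r = (\<lambda>m. m - charge t p r) ` beads t p r"

definition quotient_part :: "nat \<Rightarrow> nat list \<Rightarrow> nat \<Rightarrow> nat list" where
  "quotient_part t p r =
     (if r = 0 then bar_partition_of_set (runner_parts t p 0)
      else partition_of_frobenius
             {x. int x \<in> shifted_beads t p r} {x. - 1 - int x \<notin> shifted_beads t p r})"

definition bar_quotient :: "nat \<Rightarrow> nat list \<Rightarrow> nat list list" where
  "bar_quotient t p = map (quotient_part t p) [0..<Suc ((t - 1) div 2)]"

text \<open>The two sets on the right cover the cases of positive and of negative charge \<open>c\<close>:
  \<^term>\<open>nat c\<close> is 0 for negative \<open>c\<close>.\<close>

definition core_runner :: "nat \<Rightarrow> nat list \<Rightarrow> nat \<Rightarrow> nat set" where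
  "core_runner t p r =
     {r + i * t | i. i < nat (charge t p r)} \<union> {(t - r) + i * t | i. i < nat (- charge t p r)}"

definition bar_core :: "nat \<Rightarrow> nat list \<Rightarrow> nat list" where
  "bar_core t p = bar_partition_of_set (\<Union>r\<in>{1..(t - 1) div 2}. core_runner t p r)"

definition bar_cocore :: "nat \<Rightarrow> nat list \<Rightarrow> nat list" where
  "bar_cocore t p =
     (THE q. bar_partition q \<and> bar_core t q = [] \<and> bar_quotient t q = bar_quotient t p)"

end

(* The length of a bar-partition is the sum of the cardinalities of its runners, and the two
   runners r and t - r contribute |X_r| + |X_(t-r)|, which has the parity of the charge c_r. Since
   the core has |c_r| parts on these two runners, the length of any bar-partition is congruent to
   |X_0| plus the length of its core. The cocore has the same X_0 and an empty core. That
   there is exactly one cocore holds because Frobenius symbols determine partitions (peel off the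
   outermost hook) and shifting the beads of a runner by its charge makes the charge zero. *)
theory Submission
  imports Defs
begin

section \<open>Frobenius symbols and outermost hooks\<close>

text \<open>Wraps a hook with arm \<open>a\<close> and leg \<open>b\<close> around the diagram of
  \<open>p\<close>. The ones are the cells of the new first column that lie below \<open>p\<close>;
  the truncated subtraction is harmless when \<open>length p \<le> b\<close>.\<close>

definition add_hook :: "nat \<Rightarrow> nat \<Rightarrow> nat list \<Rightarrow> nat list" where
  "add_hook a b p = Suc a # map Suc p @ replicate (b - length p) 1"

lemma length_add_hook: "length p \<le> b \<Longrightarrow> length (add_hook a b p) = Suc b"
  by (simp add: add_hook_def)

lemma nth_add_hook_0 [simp]: "add_hook a b p ! 0 = Suc a"
  by (simp add: add_hook_def)

lemma nth_add_hook_Suc: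
  "i < b \<Longrightarrow> length p \<le> b \<Longrightarrow>
    add_hook a b p ! Suc i = (if i < length p then Suc (p ! i) else 1)"
  by (auto simp: add_hook_def nth_append)

lemma partition_add_hook:
  assumes "partition p" "\<forall>x\<in>set p. x \<le> a"
  shows "partition (add_hook a b p)"
proof -
  have "sorted_wrt (\<ge>) (replicate k (1::nat))" for k
    by (induction k) auto
  then show ?thesis
    using assms by (auto simp: partition_def add_hook_def sorted_wrt_append sorted_wrt_map)
qed

text \<open>The corner has arm \<open>a\<close>. Every other diagonal cell comes from one of
  \<open>p\<close> by raising both its row index and its part by one, which keeps the arm; the
  padding rows are too short to meet the diagonal.\<close>

lemma frobenius_arms_add_hook:
  assumes "length p \<le> b"
  shows "frobenius_arms (add_hook a b p) = insert a (frobenius_arms p)"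
proof -
  let ?h = "add_hook a b p"
  have "x \<in> frobenius_arms ?h \<longleftrightarrow>
      x = a \<or> (\<exists>i. Suc i < length ?h \<and> Suc i < ?h ! Suc i \<and> x = ?h ! Suc i - Suc (Suc i))" for x
  proof -
    have "x \<in> frobenius_arms ?h \<longleftrightarrow>
      (\<exists>i. i < length ?h \<and> i < ?h ! i \<and> x = ?h ! i - Suc i)"
      by (auto simp: frobenius_arms_def)
    also have "\<dots> \<longleftrightarrow> (0 < length ?h \<and> 0 < ?h ! 0 \<and> x = ?h ! 0 - Suc 0) \<or>
       (\<exists>i. Suc i < length ?h \<and> Suc i < ?h ! Suc i \<and> x = ?h ! Suc i - Suc (Suc i))"
      by (metis not0_implies_Suc)
    finally show ?thesis using assms by (simp add: length_add_hook)
  qed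
  moreover have "Suc i < length ?h \<and> Suc i < ?h ! Suc i \<and> x = ?h ! Suc i - Suc (Suc i)
     \<longleftrightarrow> i < length p \<and> i < p ! i \<and> x = p ! i - Suc i" for i x
    using assms by (auto simp: length_add_hook nth_add_hook_Suc split: if_splits)
  ultimately show ?thesis
    by (auto simp: frobenius_arms_def)
qed

lemma conjugate_part_add_hook_0:
  assumes "length p \<le> b"
  shows "conjugate_part (add_hook a b p) 0 = Suc b"
proof -
  have "{i. i < length (add_hook a b p) \<and> 0 < add_hook a b p ! i} = {..b}"
  proof (intro set_eqI)
    fix i show "i \<in> {i. i < length (add_hook a b p) \<and> 0 < add_hook a b p ! i} \<longleftrightarrow> i \<in> {..b}"
      using assms by (cases i) (auto simp: length_add_hook nth_add_hook_Suc)
  qed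
  then show ?thesis by (simp add: conjugate_part_def)
qed

lemma conjugate_part_add_hook_Suc:
  assumes "length p \<le> b" "j < a"
  shows "conjugate_part (add_hook a b p) (Suc j) = Suc (conjugate_part p j)"
proof -
  have "{i. i < length (add_hook a b p) \<and> Suc j < add_hook a b p ! i}
      = insert 0 (Suc ` {i. i < length p \<and> j < p ! i})" (is "?l = ?r")
  proof (intro set_eqI)
    fix i show "i \<in> ?l \<longleftrightarrow> i \<in> ?r"
      using assms by (cases i) (auto simp: length_add_hook nth_add_hook_Suc split: if_splits)
  qed
  then show ?thesis by (simp add: conjugate_part_def card_image)
qed

lemma frobenius_legs_add_hook:
  assumes "length p \<le> b" "\<forall>x\<in>set p. x \<le> a"
  shows "frobenius_legs (add_hook a b p) = insert b (frobenius_legs p)"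
proof -
  let ?h = "add_hook a b p"
  have "x \<in> frobenius_legs ?h \<longleftrightarrow> x = b \<or>
     (\<exists>i. Suc i < length ?h \<and> Suc i < ?h ! Suc i \<and> x = conjugate_part ?h (Suc i) - Suc (Suc i))" for x
  proof -
    have "x \<in> frobenius_legs ?h \<longleftrightarrow>
      (\<exists>i. i < length ?h \<and> i < ?h ! i \<and> x = conjugate_part ?h i - Suc i)"
      by (auto simp: frobenius_legs_def)
    also have "\<dots> \<longleftrightarrow> (0 < length ?h \<and> 0 < ?h ! 0 \<and> x = conjugate_part ?h 0 - Suc 0) \<or>
       (\<exists>i. Suc i < length ?h \<and> Suc i < ?h ! Suc i \<and> x = conjugate_part ?h (Suc i) - Suc (Suc i))"
      by (metis not0_implies_Suc)
    finally show ?thesis using assms by (simp add: length_add_hook conjugate_part_add_hook_0)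
  qed
  moreover have "Suc i < length ?h \<and> Suc i < ?h ! Suc i \<and>
        x = conjugate_part ?h (Suc i) - Suc (Suc i)
     \<longleftrightarrow> i < length p \<and> i < p ! i \<and> x = conjugate_part p i - Suc i" for i x
  proof (cases "i < length p \<and> i < p ! i")
    case True
    \<comment> \<open>Diagonal cells of \<open>p\<close> lie in columns below \<open>a\<close>,
      which the new first row still covers after the shift by one.\<close>
    then have "i < a" using assms(2) by (meson nth_mem order_less_le_trans)
    then show ?thesis using True assms
      by (simp add: length_add_hook nth_add_hook_Suc conjugate_part_add_hook_Suc)
  next
    case False
    then show ?thesis using assms
      by (auto simp: length_add_hook nth_add_hook_Suc split: if_splits)
  qed
  ultimately show ?thesis
    by (auto simp: frobenius_legs_def)
qed

text \<open>Deletes the first row and the first column. The leg \<open>b\<close> is the number of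
  remaining rows, and \<open>p'\<close> drops those that become empty.\<close>

lemma partition_eq_add_hook:
  assumes "partition p" "p \<noteq> []"
  obtains a b p' where "p = add_hook a b p'" "partition p'" "length p' \<le> b"
    "\<forall>x\<in>set p'. x \<le> a" "length p' < length p"
proof -
  \<comment> \<open>Since parts decrease, the ones stand at the end, so removing the first column
    empties only a final block of rows.\<close>
  have split: "\<exists>p' k. q = map Suc p' @ replicate k 1 \<and> partition p'" if "partition q" for q
    using that
  proof (induction q)
    case Nil
    then show ?case by (auto simp: partition_def)
  next
    case (Cons x q)
    then have "partition q" by (auto simp: partition_def)
    then obtain p' k where q: "q = map Suc p' @ replicate k 1" "partition p'"
      using Cons by blast
    show ?case
    proof (cases "x = 1")
      case True
      then have "\<forall>y\<in>set q. y = 1" using Cons.prems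
        by (auto simp: partition_def) (metis One_nat_def Suc_leI le_antisym not_gr0)
      then have "x # q = map Suc [] @ replicate (length (x # q)) 1"
        using True by (simp add: replicate_length_same)
      moreover have "partition []" by (simp add: partition_def)
      ultimately show ?thesis by blast
    next
      case False
      then obtain y where y: "x = Suc y" "y > 0" using Cons.prems
        by (cases x) (auto simp: partition_def)
      have "x # q = map Suc (y # p') @ replicate k 1" "partition (y # p')"
        using q y Cons.prems by (auto simp: partition_def)
      then show ?thesis by blast
    qed
  qed
  obtain x q where p: "p = x # q" using assms by (cases p) auto
  have "partition q" using assms p by (auto simp: partition_def)
  then obtain p' k where q: "q = map Suc p' @ replicate k 1" "partition p'"
    using split by blast
  obtain a where a: "x = Suc a" using assms p by (cases x) (auto simp: partition_def)
  show ?thesis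
  proof
    show "p = add_hook a (length q) p'" using p q a by (simp add: add_hook_def)
  qed (use assms p q a in \<open>auto simp: partition_def\<close>)
qed

lemma frobenius_Nil [simp]: "frobenius_arms [] = {}" "frobenius_legs [] = {}"
  by (auto simp: frobenius_arms_def frobenius_legs_def)

lemma frobenius_arms_less:
  assumes "partition p" "\<forall>x\<in>set p. x \<le> a" "x \<in> frobenius_arms p"
  shows "x < a"
  using assms by (force simp: frobenius_arms_def dest: nth_mem)

lemma conjugate_part_le_length: "conjugate_part p j \<le> length p"
proof -
  have "conjugate_part p j \<le> card {..<length p}"
    unfolding conjugate_part_def by (intro card_mono) auto
  then show ?thesis by simp
qed

lemma conjugate_part_pos:
  assumes "i < length p" "j < p ! i" shows "0 < conjugate_part p j"
  unfolding conjugate_part_def using assms by (subst card_gt_0_iff) auto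

lemma frobenius_legs_less:
  assumes "x \<in> frobenius_legs p" "length p \<le> b"
  shows "x < b"
proof -
  obtain i where "i < length p" "i < p ! i" "x = conjugate_part p i - Suc i"
    using assms by (auto simp: frobenius_legs_def)
  then show ?thesis
    \<comment> \<open>Positivity matters because the subtraction in the leg length is truncated: it
      makes the leg strictly smaller than the column.\<close>
    using conjugate_part_le_length[of p i] conjugate_part_pos[of i p i] assms(2) by linarith
qed

text \<open>Both \<open>a\<close> and \<open>b\<close> are the maximum of the common set. This lets
  the outermost hook be read off from the Frobenius symbol.\<close>

lemma insert_greatest_eqD:
  fixes a b :: nat
  assumes "insert a A = insert b B" "\<forall>x\<in>A. x < a" "\<forall>x\<in>B. x < b"
  shows "a = b" "A = B"
proof -
  show "a = b" using assms
    by (metis insertCI insertE less_asym)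
  then show "A = B" using assms
    by (metis insert_ident less_irrefl)
qed

lemma partition_eq_if_frobenius_eq:
  assumes "partition p" "partition q"
    "frobenius_arms p = frobenius_arms q" "frobenius_legs p = frobenius_legs q"
  shows "p = q"
  using assms
proof (induction p arbitrary: q rule: length_induct)
  case (1 p)
  show ?case
  proof (cases "p = [] \<or> q = []")
    case True
    \<comment> \<open>A nonempty partition has an outermost hook, so only the empty one has an empty
      symbol.\<close>
    have "frobenius_arms r \<noteq> {}" if "partition r" "r \<noteq> []" for r
      using partition_eq_add_hook[OF that] frobenius_arms_add_hook by (metis insert_not_empty)
    then show ?thesis using True 1 by (metis frobenius_Nil(1))
  next
    case False
    obtain a b p' where p: "p = add_hook a b p'" "partition p'" "length p' \<le> b"
      "\<forall>x\<in>set p'. x \<le> a" "length p' < length p"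
      using partition_eq_add_hook 1 False by metis
    obtain a' b' q' where q: "q = add_hook a' b' q'" "partition q'" "length q' \<le> b'"
      "\<forall>x\<in>set q'. x \<le> a'" "length q' < length q"
      using partition_eq_add_hook 1 False by metis
    have "insert a (frobenius_arms p') = insert a' (frobenius_arms q')"
      using p q 1(4) frobenius_arms_add_hook by metis
    then have A: "a = a'" "frobenius_arms p' = frobenius_arms q'"
      using insert_greatest_eqD frobenius_arms_less p q by metis+
    have "insert b (frobenius_legs p') = insert b' (frobenius_legs q')"
      using p q 1(5) frobenius_legs_add_hook by metis
    then have "b = b'" "frobenius_legs p' = frobenius_legs q'"
      using insert_greatest_eqD frobenius_legs_less p q by metis+
    then show ?thesis using A 1(1) p q by metis
  qed
qed

text \<open>The bounds on the parts and the length of \<open>p\<close> let the induction wrap the next hook around it.\<close>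

lemma ex_partition_frobenius:
  assumes "finite A" "finite L" "card A = card L"
  shows "\<exists>p. partition p \<and> frobenius_arms p = A \<and> frobenius_legs p = L \<and>
    (\<forall>a. (\<forall>x\<in>A. x < a) \<longrightarrow> (\<forall>x\<in>set p. x \<le> a)) \<and> (\<forall>b. (\<forall>x\<in>L. x < b) \<longrightarrow> length p \<le> b)"
  using assms
proof (induction A arbitrary: L rule: finite_linorder_max_induct)
  case empty
  then show ?case by (intro exI[of _ "[]"]) (auto simp: partition_def)
next
  case (insert a A)
  then have "L \<noteq> {}" by auto
  \<comment> \<open>The outermost hook has the greatest arm and the greatest leg, so
    \<open>a\<close> is paired with the maximum of \<open>L\<close>.\<close>
  define b where "b = Max L"
  have L: "b \<in> L" "\<forall>x\<in>L - {b}. x < b"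
    using insert.prems \<open>L \<noteq> {}\<close> by (auto simp: b_def order.strict_iff_order)
  have "a \<notin> A" using insert by auto
  then have "card A = card (L - {b})" using insert L by simp
  then obtain p where p: "partition p" "frobenius_arms p = A" "frobenius_legs p = L - {b}"
    "\<forall>a. (\<forall>x\<in>A. x < a) \<longrightarrow> (\<forall>x\<in>set p. x \<le> a)"
    "\<forall>b'. (\<forall>x\<in>L - {b}. x < b') \<longrightarrow> length p \<le> b'"
    using insert.IH[of "L - {b}"] insert.prems by auto
  have len: "length p \<le> b" and le: "\<forall>x\<in>set p. x \<le> a"
    using p L insert by auto
  show ?case
  proof (intro exI conjI allI impI)
    show "partition (add_hook a b p)" by (simp add: partition_add_hook p le)
    show "frobenius_arms (add_hook a b p) = insert a A"
      using frobenius_arms_add_hook[OF len] p by simp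
    show "frobenius_legs (add_hook a b p) = L"
      using frobenius_legs_add_hook[OF len le] p L by auto
    show "\<forall>x\<in>set (add_hook a b p). x \<le> a'" if "\<forall>x\<in>insert a A. x < a'" for a'
      using that le by (fastforce simp: add_hook_def)
    show "length (add_hook a b p) \<le> b'" if "\<forall>x\<in>L. x < b'" for b'
      using that L len by (auto simp: length_add_hook)
  qed
qed

text \<open>Existence and uniqueness make the definite description meaningful; hence both sets can
  be recovered from the partition.\<close>

lemma partition_of_frobenius_correct:
  assumes "finite A" "finite L" "card A = card L"
  shows "frobenius_arms (partition_of_frobenius A L) = A"
    and "frobenius_legs (partition_of_frobenius A L) = L"
proof -
  have "\<exists>!p. partition p \<and> frobenius_arms p = A \<and> frobenius_legs p = L"
  proof -
    obtain p where "partition p" "frobenius_arms p = A" "frobenius_legs p = L"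
      using ex_partition_frobenius[OF assms] by metis
    then show ?thesis using partition_eq_if_frobenius_eq by (intro ex1I[of _ p]) auto
  qed
  from theI'[OF this] show "frobenius_arms (partition_of_frobenius A L) = A"
    and "frobenius_legs (partition_of_frobenius A L) = L"
    unfolding partition_of_frobenius_def by auto
qed

section \<open>Bead sets and their shifts\<close>

text \<open>Separates the bead set from any particular bar-partition, so that a shifted bead set can
  be described by a new pair of sets.\<close>

definition beads_of :: "nat set \<Rightarrow> nat set \<Rightarrow> int set" where
  "beads_of P Q = int ` P \<union> {- 1 - int x | x. x \<notin> Q}"

lemma int_in_beads_of [simp]: "int x \<in> beads_of P Q \<longleftrightarrow> x \<in> P"
  by (auto simp: beads_of_def)

lemma neg_in_beads_of [simp]: "- 1 - int x \<in> beads_of P Q \<longleftrightarrow> x \<notin> Q"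
  by (auto simp: beads_of_def)

text \<open>Every integer is either \<open>int x\<close> or \<open>- 1 - int x\<close> for a natural
  \<open>x\<close>, so any set of integers is encoded by its nonnegative beads and its negative
  gaps.\<close>

lemma beads_of_collect: "beads_of {x. int x \<in> M} {x. - 1 - int x \<notin> M} = M"
proof (intro set_eqI)
  fix m :: int
  consider x where "m = int x" | x where "m = - 1 - int x"
  proof (cases "0 \<le> m")
    case True
    then show ?thesis using that(1)[of "nat m"] by simp
  next
    case False
    then show ?thesis using that(2)[of "nat (- 1 - m)"] by simp
  qed
  then show "m \<in> beads_of {x. int x \<in> M} {x. - 1 - int x \<notin> M} \<longleftrightarrow> m \<in> M"
    by cases simp_all
qed

text \<open>Counting beads above a far enough level turns the charge into a cardinality that a shift of
  the beads visibly preserves.\<close>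

lemma card_beads_of_above:
  assumes "finite P" "\<forall>x\<in>Q. x < k"
  shows "finite (beads_of P Q \<inter> {- int k..})"
    and "int (card (beads_of P Q \<inter> {- int k..})) = int (card P) - int (card Q) + int k"
proof -
  \<comment> \<open>Position \<open>- 1 - int x\<close> is at or above level \<open>- int k\<close>
    exactly when \<open>x < k\<close>, and every gap in \<open>Q\<close> satisfies this.\<close>
  have eq: "beads_of P Q \<inter> {- int k..} = int ` P \<union> (\<lambda>x. - 1 - int x) ` ({..<k} - Q)"
    by (auto simp: beads_of_def)
  show "finite (beads_of P Q \<inter> {- int k..})" unfolding eq using assms(1) by simp
  have "card (beads_of P Q \<inter> {- int k..}) = card P + card ({..<k} - Q)"
    unfolding eq using assms(1)
    by (subst card_Un_disjoint) (auto simp: card_image inj_on_def)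
  moreover have "Q \<subseteq> {..<k}" using assms(2) by auto
  then have "card ({..<k} - Q) = k - card Q" "card Q \<le> k"
    using card_mono[of "{..<k}" Q] by (simp_all add: card_Diff_subset finite_subset)
  ultimately show "int (card (beads_of P Q \<inter> {- int k..})) = int (card P) - int (card Q) + int k"
    by simp
qed

text \<open>If the level moves along with the beads, from \<open>- int k\<close> to
  \<open>- int k - c\<close>, the number of beads above it is unchanged. Comparing the two counts
  gives the new charge.\<close>

lemma shift_beads_of:
  assumes "finite P" "finite Q"
    and P': "P' = {x. int x \<in> (\<lambda>m. m - c) ` beads_of P Q}"
    and Q': "Q' = {x. - 1 - int x \<notin> (\<lambda>m. m - c) ` beads_of P Q}"
  shows "finite P'" "finite Q'" "int (card P') - int (card Q') = int (card P) - int (card Q) - c"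
proof -
  let ?M = "beads_of P Q"
  have mem: "m \<in> (\<lambda>m. m - c) ` ?M \<longleftrightarrow> m + c \<in> ?M" for m
    by (force simp: image_iff)
  obtain k0 where k0: "\<forall>x\<in>Q. x < k0"
    using assms(2) by (meson finite_nat_set_iff_bounded)
  obtain l0 where l0: "\<forall>x\<in>P. x < l0"
    using assms(1) by (meson finite_nat_set_iff_bounded)
  \<comment> \<open>The margin \<open>\<bar>c\<bar>\<close> keeps \<open>int k + c\<close>
    nonnegative, so that \<open>k'\<close> is not truncated.\<close>
  define k where "k = k0 + nat \<bar>c\<bar>"
  define k' where "k' = nat (int k + c)"
  have k': "int k' = int k + c" by (simp add: k'_def k_def)
  \<comment> \<open>Far below the fence every position is black and far above it every position is
    white; this survives the shift and bounds \<open>P'\<close> and \<open>Q'\<close>.\<close>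
  have low: "m \<in> ?M" if "m < - int k0" for m
  proof -
    have "m = - 1 - int (nat (- 1 - m))" using that by simp
    moreover have "nat (- 1 - m) \<notin> Q" using k0 that by force
    ultimately show ?thesis by (metis neg_in_beads_of)
  qed
  have high: "m \<notin> ?M" if "m \<ge> int l0" for m
  proof -
    have "m = int (nat m)" using that by simp
    moreover have "nat m \<notin> P" using l0 that by force
    ultimately show ?thesis by (metis int_in_beads_of)
  qed
  have "P' \<subseteq> {..l0 + nat \<bar>c\<bar>}"
  proof
    fix x assume "x \<in> P'"
    then have "int x + c \<in> ?M" unfolding P' mem by simp
    then have "\<not> int l0 \<le> int x + c" using high by blast
    then show "x \<in> {..l0 + nat \<bar>c\<bar>}" by simp
  qed
  then show "finite P'" by (rule finite_subset) simp
  have Qk: "\<forall>x\<in>Q'. x < k'"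
  proof
    fix x assume "x \<in> Q'"
    then have "- 1 - int x + c \<notin> ?M" unfolding Q' mem by simp
    then have "\<not> - 1 - int x + c < - int k0" using low by blast
    then show "x < k'" using k' by (auto simp: k_def)
  qed
  then show "finite Q'" by (meson finite_nat_set_iff_bounded)
  show "int (card P') - int (card Q') = int (card P) - int (card Q) - c"
  proof -
    have "beads_of P' Q' = (\<lambda>m. m - c) ` ?M" unfolding P' Q' by (rule beads_of_collect)
    then have "beads_of P' Q' \<inter> {- int k'..} = (\<lambda>m. m - c) ` (?M \<inter> {- int k..})"
      using k' by auto
    then have "card (beads_of P' Q' \<inter> {- int k'..}) = card (?M \<inter> {- int k..})"
      by (simp add: card_image inj_on_def)
    moreover have "\<forall>x\<in>Q. x < k" using k0 by (auto simp: k_def)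
    ultimately show ?thesis
      using card_beads_of_above(2)[OF assms(1), of Q k]
        card_beads_of_above(2)[OF \<open>finite P'\<close> Qk] k' by linarith
  qed
qed

section \<open>Runners and the length of the core\<close>

lemma set_bar_partition_of_set [simp]: "finite S \<Longrightarrow> set (bar_partition_of_set S) = S"
  by (simp add: bar_partition_of_set_def)

lemma length_bar_partition_of_set [simp]: "length (bar_partition_of_set S) = card S"
  by (simp add: bar_partition_of_set_def)

lemma bar_partition_of_set: "finite S \<Longrightarrow> 0 \<notin> S \<Longrightarrow> bar_partition (bar_partition_of_set S)"
  by (simp add: bar_partition_of_set_def bar_partition_def partition_def sorted_wrt_rev)

lemma bar_partition_eq_of_set:
  assumes "bar_partition p"
  shows "p = bar_partition_of_set (set p)"
proof -
  have "sorted (rev p)" "distinct (rev p)"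
    using assms by (auto simp: bar_partition_def partition_def sorted_wrt_rev)
  then have "sorted_list_of_set (set (rev p)) = rev p"
    by (rule sorted_list_of_set.idem_if_sorted_distinct)
  then show ?thesis by (simp add: bar_partition_of_set_def)
qed

lemma bar_partition_eq_iff:
  "bar_partition p \<Longrightarrow> bar_partition q \<Longrightarrow> p = q \<longleftrightarrow> set p = set q"
  using bar_partition_eq_of_set[of p] bar_partition_eq_of_set[of q] by auto

lemma finite_runner_parts:
  assumes "0 < t" shows "finite (runner_parts t p r)"
proof -
  have "(\<lambda>x. t * x + r) ` runner_parts t p r \<subseteq> set p" by (auto simp: runner_parts_def)
  then have "finite ((\<lambda>x. t * x + r) ` runner_parts t p r)" by (rule finite_subset) simp
  then show ?thesis by (rule finite_imageD) (use assms in \<open>auto simp: inj_on_def\<close>)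
qed

text \<open>Division by \<open>t\<close> with remainder matches the parts with pairs of a runner and
  a position on it.\<close>

lemma length_eq_sum_runner_parts:
  assumes "0 < t" "distinct p"
  shows "length p = (\<Sum>r<t. card (runner_parts t p r))"
proof -
  have "bij_betw (\<lambda>(r, x). t * x + r) (SIGMA r:{..<t}. runner_parts t p r) (set p)"
    by (rule bij_betw_byWitness[where f' = "\<lambda>y. (y mod t, y div t)"])
       (use assms(1) in \<open>auto simp: runner_parts_def\<close>)
  then have "card (SIGMA r:{..<t}. runner_parts t p r) = card (set p)"
    by (rule bij_betw_same_card)
  then show ?thesis
    using assms by (simp add: distinct_card finite_runner_parts)
qed

text \<open>For odd \<open>t\<close> the reflection taking \<open>r\<close> to \<open>t - r\<close>
  exchanges the lower and upper halves of the nonzero residues without a fixed point.\<close>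

lemma sum_lessThan_odd_pairs:
  fixes f :: "nat \<Rightarrow> nat"
  assumes "odd t"
  shows "(\<Sum>r<t. f r) = f 0 + (\<Sum>r\<in>{1..(t - 1) div 2}. f r + f (t - r))"
proof -
  define n where "n = (t - 1) div 2"
  have t: "t = 2 * n + 1" using assms by (auto simp: n_def elim: oddE)
  have "{..<t} = insert 0 ({1..n} \<union> {n+1..2*n})" using t by auto
  then have "(\<Sum>r<t. f r) = f 0 + ((\<Sum>r\<in>{1..n}. f r) + (\<Sum>r\<in>{n+1..2*n}. f r))"
    by (simp add: sum.union_disjoint)
  also have "(\<Sum>r\<in>{n+1..2*n}. f r) = (\<Sum>r\<in>{1..n}. f (t - r))"
    by (rule sum.reindex_bij_witness[of _ "\<lambda>r. t - r" "\<lambda>r. t - r"]) (auto simp: t)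
  finally show ?thesis by (simp add: n_def sum.distrib)
qed

lemma card_core_runner:
  assumes "0 < t"
  shows "finite (core_runner t p r)" "card (core_runner t p r) = nat \<bar>charge t p r\<bar>"
proof -
  have prog: "finite {s + i * t | i. i < k} \<and> card {s + i * t | i. i < k} = k" for s k
  proof -
    have "{s + i * t | i. i < k} = (\<lambda>i. s + i * t) ` {..<k}" by auto
    then show ?thesis using assms by (simp add: card_image inj_on_def)
  qed
  show "finite (core_runner t p r)" using prog by (simp add: core_runner_def)
  \<comment> \<open>A charge and its negative are not both positive, so at least one of the two
    progressions is empty.\<close>
  show "card (core_runner t p r) = nat \<bar>charge t p r\<bar>"
    using prog by (cases "charge t p r \<ge> 0") (auto simp: core_runner_def)
qed

lemma core_runner_mod:
  assumes "1 \<le> r" "r \<le> (t - 1) div 2" "x \<in> core_runner t p r"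
  shows "x mod t = r \<or> x mod t = t - r"
proof -
  have "r < t" "t - r < t" using assms by auto
  then have "(r + i * t) mod t = r" "((t - r) + i * t) mod t = t - r" for i
    by (simp_all only: mod_mult_self1 mod_less)
  then show ?thesis using assms(3) unfolding core_runner_def by blast
qed

lemma length_bar_core:
  assumes "0 < t"
  shows "length (bar_core t p) = (\<Sum>r\<in>{1..(t - 1) div 2}. nat \<bar>charge t p r\<bar>)"
proof -
  have "core_runner t p r \<inter> core_runner t p s = {}"
    if "r \<in> {1..(t - 1) div 2}" "s \<in> {1..(t - 1) div 2}" "r \<noteq> s" for r s
  proof -
    \<comment> \<open>Both indices are at most \<open>(t - 1) div 2\<close>, so
      \<open>r + s < t\<close>. The residues of the two core runners are therefore disjoint.\<close>
    have "r \<noteq> t - s" "t - r \<noteq> t - s" "t - r \<noteq> s" using that by auto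
    then show ?thesis using that core_runner_mod by (metis atLeastAtMost_iff disjoint_iff)
  qed
  then have "card (\<Union>r\<in>{1..(t - 1) div 2}. core_runner t p r) =
      (\<Sum>r\<in>{1..(t - 1) div 2}. card (core_runner t p r))"
    using card_core_runner[OF assms] by (intro card_UN_disjoint) auto
  then show ?thesis using card_core_runner[OF assms] by (simp add: bar_core_def)
qed

lemma bar_core_Nil_iff:
  assumes "0 < t"
  shows "bar_core t p = [] \<longleftrightarrow> (\<forall>r\<in>{1..(t - 1) div 2}. charge t p r = 0)"
  using length_bar_core[OF assms, of p] by (auto simp flip: length_0_conv)

section \<open>Existence and uniqueness of the cocore\<close>

lemma bar_quotient_eq_iff:
  "bar_quotient t q = bar_quotient t p \<longleftrightarrow>
    (\<forall>r\<le>(t - 1) div 2. quotient_part t q r = quotient_part t p r)"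
  by (auto simp: bar_quotient_def)

lemma quotient_part_0: "quotient_part t p 0 = bar_partition_of_set (runner_parts t p 0)"
  by (simp add: quotient_part_def)

lemma beads_eq: "beads t p r = beads_of (runner_parts t p r) (runner_parts t p (t - r))"
  by (simp add: beads_def beads_of_def)

text \<open>Without charge nothing is shifted: the arms are the positions on runner \<open>r\<close>
  and the legs those on runner \<open>t - r\<close>.\<close>

lemma quotient_part_neutral:
  assumes "r \<noteq> 0" "charge t p r = 0"
  shows "quotient_part t p r =
    partition_of_frobenius (runner_parts t p r) (runner_parts t p (t - r))"
  using assms by (simp add: quotient_part_def shifted_beads_def beads_eq)

lemma bar_partition_eq_if_runner_parts_eq:
  assumes "0 < t" "bar_partition p" "bar_partition q"
    "\<And>r. r < t \<Longrightarrow> runner_parts t p r = runner_parts t q r"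
  shows "p = q"
proof -
  have "y \<in> set p \<longleftrightarrow> y \<in> set q" for y
    using assms(4)[of "y mod t"] assms(1) unfolding runner_parts_def
    by (metis (no_types, lifting) mem_Collect_eq mod_less_divisor mult_div_mod_eq)
  then show ?thesis using assms bar_partition_eq_iff by blast
qed

text \<open>Distinct residues modulo \<open>t\<close> do not interact, so the runners can be
  prescribed independently. Only position 0 on runner 0 would give the forbidden part 0.\<close>

lemma ex_bar_partition_runner_parts:
  assumes "0 < t" "0 \<notin> X 0" "\<And>r. r < t \<Longrightarrow> finite (X r)"
  shows "\<exists>q. bar_partition q \<and> (\<forall>r<t. runner_parts t q r = X r)"
proof -
  let ?S = "\<Union>r<t. (\<lambda>x. t * x + r) ` X r"
  have "finite ?S" using assms by simp
  moreover have "0 \<notin> ?S" using assms(1,2) by auto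
  moreover have "t * x + r \<in> ?S \<longleftrightarrow> x \<in> X r" if "r < t" for x r
  proof
    assume "t * x + r \<in> ?S"
    then obtain s y where s: "s < t" "y \<in> X s" "t * x + r = t * y + s" by auto
    have "r = s" using s that by (metis mod_less mod_mult_self4)
    then show "x \<in> X r" using s assms(1) by simp
  qed (use that in auto)
  ultimately show ?thesis
    by (intro exI[of _ "bar_partition_of_set ?S"])
       (simp add: bar_partition_of_set runner_parts_def)
qed

text \<open>An empty core makes all charges vanish, so each quotient part has the two runners
  themselves as its Frobenius symbol and thus determines them.\<close>

lemma bar_cocore_unique:
  assumes "0 < t" "odd t" "bar_partition p" "bar_partition q"
    "bar_core t p = []" "bar_core t q = []" "bar_quotient t p = bar_quotient t q"
  shows "p = q"
proof (rule bar_partition_eq_if_runner_parts_eq[OF assms(1,3,4)])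
  have quot: "quotient_part t p r = quotient_part t q r" if "r \<le> (t - 1) div 2" for r
    using assms(7) that bar_quotient_eq_iff by blast
  have zero: "runner_parts t p 0 = runner_parts t q 0"
    using quot[of 0] finite_runner_parts[OF assms(1)] set_bar_partition_of_set
    by (metis quotient_part_0 zero_le)
  have pair: "runner_parts t p r = runner_parts t q r \<and>
      runner_parts t p (t - r) = runner_parts t q (t - r)"
    if r: "1 \<le> r" "r \<le> (t - 1) div 2" for r
  proof -
    have c: "charge t p r = 0" "charge t q r = 0"
      using r assms bar_core_Nil_iff by auto
    then have "card (runner_parts t p r) = card (runner_parts t p (t - r))"
      "card (runner_parts t q r) = card (runner_parts t q (t - r))"
      by (auto simp: charge_def)
    moreover have "partition_of_frobenius (runner_parts t p r) (runner_parts t p (t - r)) =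
      partition_of_frobenius (runner_parts t q r) (runner_parts t q (t - r))"
      using quot[OF r(2)] quotient_part_neutral c r by (metis not_one_le_zero)
    ultimately show ?thesis
      using partition_of_frobenius_correct finite_runner_parts[OF assms(1)] by metis
  qed
  fix r assume "r < t"
  \<comment> \<open>As \<open>t\<close> is odd, a residue in the upper half is the partner of one in
    the lower half.\<close>
  then consider "r = 0" | "1 \<le> r" "r \<le> (t - 1) div 2"
    | "1 \<le> t - r" "t - r \<le> (t - 1) div 2" "t - (t - r) = r"
  proof -
    obtain b where "t = 2 * b + 1" using assms(2) by (rule oddE)
    then show thesis using \<open>r < t\<close> that by (cases "r = 0"; cases "r \<le> b") auto
  qed
  then show "runner_parts t p r = runner_parts t q r"
    using zero pair[of r] pair[of "t - r"] by cases auto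
qed

lemma ex_bar_cocore:
  assumes "0 < t" "bar_partition p"
  shows "\<exists>q. bar_partition q \<and> bar_core t q = [] \<and> bar_quotient t q = bar_quotient t p"
proof -
  define n where "n = (t - 1) div 2"
  define P where "P r = {x. int x \<in> shifted_beads t p r}" for r
  define Q where "Q r = {x. - 1 - int x \<notin> shifted_beads t p r}" for r
  \<comment> \<open>The witness carries on runners \<open>r\<close> and \<open>t - r\<close> the
    arms and legs of the quotient part of \<open>p\<close>, that is, the beads of \<open>p\<close>
    shifted to charge zero.\<close>
  define X where "X r = (if r = 0 then runner_parts t p 0 else if r \<le> n then P r else Q (t - r))" for r
  \<comment> \<open>Shifting by the charge itself leaves the difference of the cardinalities
    zero.\<close>
  have PQ: "finite (P r)" "finite (Q r)" "card (P r) = card (Q r)" for r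
    using shift_beads_of[of "runner_parts t p r" "runner_parts t p (t - r)" "P r" "charge t p r" "Q r"]
      finite_runner_parts[OF assms(1)]
    by (auto simp: P_def Q_def shifted_beads_def beads_eq charge_def)
  have "0 \<notin> X 0"
    using assms(2) by (simp add: X_def runner_parts_def bar_partition_def partition_def)
  moreover have "finite (X r)" for r
    using PQ finite_runner_parts[OF assms(1)] by (simp add: X_def)
  ultimately obtain q where q: "bar_partition q" "\<And>r. r < t \<Longrightarrow> runner_parts t q r = X r"
    using ex_bar_partition_runner_parts[OF assms(1)] by metis
  have zero: "runner_parts t q 0 = runner_parts t p 0" using q assms by (simp add: X_def)
  have pair: "runner_parts t q r = P r" "runner_parts t q (t - r) = Q r"
    if "1 \<le> r" "r \<le> n" for r
  proof -
    have "r < t" "t - r < t" "\<not> t - r \<le> n" "t - (t - r) = r" "t - r \<noteq> 0"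
      using that assms(1) by (auto simp: n_def)
    then show "runner_parts t q r = P r" "runner_parts t q (t - r) = Q r"
      using that q by (auto simp: X_def)
  qed
  have c: "charge t q r = 0" if "1 \<le> r" "r \<le> n" for r
    using pair[OF that] PQ by (simp add: charge_def)
  then have "bar_core t q = []"
    using bar_core_Nil_iff[OF assms(1)] by (simp add: n_def)
  moreover have "quotient_part t q r = quotient_part t p r" if "r \<le> n" for r
  proof (cases "r = 0")
    case True
    then show ?thesis by (simp add: quotient_part_0 zero)
  next
    case False
    then have r: "1 \<le> r" by simp
    show ?thesis using quotient_part_neutral[OF False c[OF r that]] pair[OF r that] False
      by (simp add: quotient_part_def P_def Q_def)
  qed
  ultimately show ?thesis using q(1) bar_quotient_eq_iff by (metis n_def)
qed

lemma bar_cocore_correct: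
  assumes "0 < t" "odd t" "bar_partition p"
  shows "bar_partition (bar_cocore t p)" "bar_core t (bar_cocore t p) = []"
    "bar_quotient t (bar_cocore t p) = bar_quotient t p"
proof -
  have "\<exists>!q. bar_partition q \<and> bar_core t q = [] \<and> bar_quotient t q = bar_quotient t p"
    using ex_bar_cocore[OF assms(1,3)] bar_cocore_unique[OF assms(1,2)] by metis
  from theI'[OF this] show "bar_partition (bar_cocore t p)" "bar_core t (bar_cocore t p) = []"
    "bar_quotient t (bar_cocore t p) = bar_quotient t p"
    unfolding bar_cocore_def by auto
qed

section \<open>Parity of the length\<close>

text \<open>The two sides differ by twice the smaller of \<open>a\<close> and
  \<open>b\<close>.\<close>

lemma cong_add_nat_abs_diff: "[a + b = nat \<bar>int a - int b\<bar>] (mod 2)"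
proof (cases "a \<le> b")
  case True
  then have "b = a + (b - a)" "nat \<bar>int a - int b\<bar> = b - a" by auto
  then show ?thesis by (metis add.assoc cong_def mod_mult_self4 mult_2 mult.commute)
next
  case False
  then have "a = b + (a - b)" "nat \<bar>int a - int b\<bar> = a - b" by auto
  then show ?thesis by (metis add.assoc add.commute cong_def mod_mult_self4 mult_2 mult.commute)
qed

text \<open>Applied both to \<open>p\<close> and to its cocore, which share the contribution of
  runner 0.\<close>

lemma cong_length_bar_core:
  assumes "0 < t" "odd t" "bar_partition p"
  shows "[length p = card (runner_parts t p 0) + length (bar_core t p)] (mod 2)"
proof -
  let ?c = "\<lambda>r. card (runner_parts t p r)"
  have "length p = ?c 0 + (\<Sum>r\<in>{1..(t - 1) div 2}. ?c r + ?c (t - r))"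
    using length_eq_sum_runner_parts[of t p] sum_lessThan_odd_pairs[OF assms(2), of ?c] assms
    by (simp add: bar_partition_def)
  moreover have "[?c r + ?c (t - r) = nat \<bar>charge t p r\<bar>] (mod 2)" for r
    unfolding charge_def by (rule cong_add_nat_abs_diff)
  then have "[(\<Sum>r\<in>{1..(t - 1) div 2}. ?c r + ?c (t - r)) = length (bar_core t p)] (mod 2)"
    unfolding length_bar_core[OF assms(1)] by (intro cong_sum)
  ultimately show ?thesis
    by (simp only: cong_add_lcancel_nat)
qed

theorem lemma3p11:
  fixes t :: nat and p :: "nat list"
  assumes "0 < t" and "odd t" and "bar_partition p"
  shows "[int (length p) - int (length (bar_core t p)) - int (length (bar_cocore t p)) = 0] (mod 2)"
proof -
  let ?q = "bar_cocore t p"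
  note q = bar_cocore_correct[OF assms]
  have "quotient_part t ?q 0 = quotient_part t p 0"
    using q(3) bar_quotient_eq_iff by blast
  then have "card (runner_parts t ?q 0) = card (runner_parts t p 0)"
    by (metis quotient_part_0 length_bar_partition_of_set)
  then have "[length ?q = card (runner_parts t p 0)] (mod 2)"
    using cong_length_bar_core[OF assms(1,2) q(1)] q(2) by simp
  \<comment> \<open>Signs are irrelevant modulo 2; the sum is congruent to twice
    \<open>card (runner_parts t p 0) + length (bar_core t p)\<close>.\<close>
  then have "even (length p + length (bar_core t p) + length ?q)"
    using cong_length_bar_core[OF assms] unfolding cong_def by presburger
  then show ?thesis
    by (simp add: cong_0_iff)
qed

end
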